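(* Let $G=(V,E,\omega)\in\mathbb{G}_\pi$ and let $\mathcal{V}\subseteq V$ contain at least two vertices. Then $\mathcal{BW}_{\mathcal K}(\mathcal{R}_{\mathcal{V}}[G])\subseteq\mathcal{BW}_{\mathcal K}(G)$.
   Context: Let $\mathbb{W}$ be the field of rational functions $p/q$ with $p,q\in\mathbb{C}[\lambda]$, $q\neq 0$, always written in lowest terms (zero is written $0/1$). $\mathbb{G}$ is the set of finite weighted digraphs $G=(V,E,\omega)$, loops allowed, no parallel edges, with $\omega:E\to\mathbb{W}$ and the convention $\omega(e)=0$ iff $e\notin E$; $\mathbb{G}^n$ is the set of those with $n$ vertices. Write $V=\{v_1,\dots,v_n\}$, $e_{ij}=(v_i,v_j)$, and let $M(G)\in\mathbb{W}^{n\times n}$, $M(G)_{ij}=\omega(e_{ij})$, be the weighted adjacency matrix. $\mathbb{G}_\pi^n\subset\mathbb{G}^n$ is the set of graphs all of whose weights are of the form $p/q$ with $\deg(p)\leq\deg(q)$ (the zero weight is allowed), and $\mathbb{G}_\pi=\bigcup_{n\ge1}\mathbb{G}_\pi^n$. Polynomial extension: for $G\in\mathbb{G}^n$ with $M(G)_{ij}=p_{ij}/q_{ij}$ let $L_i(G)=\prod_{j=1}^n q_{ij}$. The graph $\bar G$ has adjacency matrix $M(\bar G)_{ij}=L_i(G)M(G)_{ij}$ for $i\ne j$ and $M(\bar G)_{ii}=L_i(G)(M(G)_{ii}-\lambda)+\lambda$; its entries are polynomials in $\lambda$, so it may be evaluated at any $\lambda\in\mathbb{C}$. Put $r_i(\bar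 G)=\sum_{j\ne i}|M(\bar G)_{ij}|$ (a function of $\lambda\in\mathbb{C}$). Brauer-type region (for a graph with $n\ge2$ vertices): $\mathcal{BW}_{\mathcal K}(G)=\bigcup_{1\le i,j\le n,\ i\ne j}\{\lambda\in\mathbb{C}:|\lambda-M(\bar G)_{ii}||\lambda-M(\bar G)_{jj}|\le r_i(\bar G)r_j(\bar G)\}$. Isospectral reduction: a nonempty $S\subseteq V$ is a structural set of $G$ if every cycle of $G$ that is not a loop contains a vertex of $S$, and $\omega(e_{ii})\ne\lambda$ for every $v_i\in V\setminus S$. For $v_i,v_j\in S$, a branch from $v_i$ to $v_j$ is a sequence of vertices $u_1=v_i,u_2,\dots,u_m=v_j$ ($m\ge2$) with $(u_k,u_{k+1})\in E$ for all $k$, all vertices distinct except that $u_1=u_m$ when $i=j$, and interior vertices $u_2,\dots,u_{m-1}\notin S$; its branch product is $\omega(u_1,u_2)\prod_{k=2}^{m-1}\frac{\omega(u_k,u_{k+1})}{\lambda-\omega(u_k,u_k)}$. The reduction $\mathcal{R}_S(G)$ is the graph with vertex set $S$ whose edge $(v_i,v_j)$ has weight equal to the sum of the branch products of all branches from $v_i$ to $v_j$ (no edge if this is $0$). A sequence of reductions on $G$ with final vertex set $\mathcal V$ is a sequence $S_1,\dots,S_m=\mathcal V$ with $S_1$ a structural set of $G$, $\mathcal{R}_1=\mathcal{R}_{S_1}(G)$, $S_{i+1}$ a structural set of $\mathcal{R}_i$, and $\mathcal{R}_{i+1}=\mathcal{R}_{S_{i+1}}(\mathcal{R}_i)$. It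 is known that for $G\in\mathbb{G}_\pi$ and any nonempty $\mathcal{V}\subseteq V$ such a sequence exists and that the final graph $\mathcal{R}_m$ depends only on $\mathcal{V}$; it is denoted $\mathcal{R}_{\mathcal{V}}[G]$. *)

theory Defs
  imports
    Complex_Main
    "HOL-Computational_Algebra.Computational_Algebra"
    "HOL-Computational_Algebra.Field_as_Ring"
begin

section \<open>Rational functions\<close>

type_synonym ratfun = "complex poly fract"

definition lam :: ratfun where
  "lam = to_fract [:0, 1:]"

text \<open>
  Lowest terms, with monic denominator; zero is written 0/1. The informal lowest terms are unique
  only up to a common constant factor, but replacing \<open>q\<close> by \<open>c q\<close> with \<open>c \<noteq> 0\<close> does not affect any
  degree, and multiplies both sides of the inequality defining the Brauer-type region
  by the same positive constant.
\<close>

definition numer :: "ratfun \<Rightarrow> complex poly" where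
  "numer f = fst (quot_of_fract f)"

definition denom :: "ratfun \<Rightarrow> complex poly" where
  "denom f = snd (quot_of_fract f)"

text \<open>
  This is only ever applied to rational functions that are polynomials, where \<open>denom f = 1\<close>
  (see \<open>denom_poly_ext_weight\<close> below).
\<close>

definition eval_ratfun :: "ratfun \<Rightarrow> complex \<Rightarrow> complex" where
  "eval_ratfun f z = poly (numer f) z / poly (denom f) z"


section \<open>Weighted digraphs\<close>

text \<open>
  Since \<open>\<omega>(e) = 0\<close> iff \<open>e \<notin> E\<close>, the edge set is determined by the weights and is not stored
  separately. \<open>weight G u v\<close> is the entry of the weighted adjacency matrix in row \<open>u\<close>, column \<open>v\<close>.
\<close>

record 'v wgraph =
  verts :: "'v set"
  weight :: "'v \<Rightarrow> 'v \<Rightarrow> ratfun"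

definition edges :: "'v wgraph \<Rightarrow> ('v \<times> 'v) set" where
  "edges G = {(u, v). u \<in> verts G \<and> v \<in> verts G \<and> weight G u v \<noteq> 0}"

text \<open>Pinning the weight to \<open>0\<close> off the vertex set makes equality of graphs the equality of records.\<close>

definition graphs :: "'v wgraph set" where
  "graphs = {G. finite (verts G) \<and> verts G \<noteq> {} \<and>
     (\<forall>u v. weight G u v \<noteq> 0 \<longrightarrow> u \<in> verts G \<and> v \<in> verts G)}"

definition graphs_pi :: "'v wgraph set" where
  "graphs_pi = {G \<in> graphs. \<forall>u \<in> verts G. \<forall>v \<in> verts G.
     degree (numer (weight G u v)) \<le> degree (denom (weight G u v))}"


section \<open>Polynomial extension and the Brauer-type region\<close>

definition row_denom :: "'v wgraph \<Rightarrow> 'v \<Rightarrow> complex poly" where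
  "row_denom G u = (\<Prod>v \<in> verts G. denom (weight G u v))"

definition poly_ext :: "'v wgraph \<Rightarrow> 'v wgraph" where
  "poly_ext G = \<lparr>verts = verts G,
     weight = (\<lambda>u v.
       if u \<in> verts G \<and> v \<in> verts G then
         (if u = v then to_fract (row_denom G u) * (weight G u u - lam) + lam
          else to_fract (row_denom G u) * weight G u v)
       else 0)\<rparr>"

definition abs_row_sum :: "'v wgraph \<Rightarrow> 'v \<Rightarrow> complex \<Rightarrow> real" where
  "abs_row_sum H u z = (\<Sum>v \<in> verts H - {u}. cmod (eval_ratfun (weight H u v) z))"

definition brauer_region :: "'v wgraph \<Rightarrow> complex set" where
  "brauer_region G = (\<Union>u \<in> verts G. \<Union>v \<in> verts G - {u}.
     {z. cmod (z - eval_ratfun (weight (poly_ext G) u u) z)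
           * cmod (z - eval_ratfun (weight (poly_ext G) v v) z)
         \<le> abs_row_sum (poly_ext G) u z * abs_row_sum (poly_ext G) v z})"


section \<open>Isospectral reduction\<close>

text \<open>
  A cycle is given as a closed sequence \<open>u\<^sub>1, \<dots>, u\<^sub>m = u\<^sub>1\<close> with the first vertex repeated
  at the end, so that a loop is a cycle \<open>[u, u]\<close>.
\<close>

definition cycle :: "'v wgraph \<Rightarrow> 'v list \<Rightarrow> bool" where
  "cycle G p \<longleftrightarrow> length p \<ge> 2 \<and> hd p = last p \<and> distinct (tl p) \<and>
     successively (\<lambda>u v. (u, v) \<in> edges G) p"

definition structural_set :: "'v wgraph \<Rightarrow> 'v set \<Rightarrow> bool" where
  "structural_set G S \<longleftrightarrow> S \<noteq> {} \<and> S \<subseteq> verts G \<and>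
     (\<forall>p. cycle G p \<and> length p \<noteq> 2 \<longrightarrow> set p \<inter> S \<noteq> {}) \<and>
     (\<forall>v \<in> verts G - S. weight G v v \<noteq> lam)"

definition branch :: "'v wgraph \<Rightarrow> 'v set \<Rightarrow> 'v \<Rightarrow> 'v \<Rightarrow> 'v list \<Rightarrow> bool" where
  "branch G S u v p \<longleftrightarrow> length p \<ge> 2 \<and> hd p = u \<and> last p = v \<and>
     successively (\<lambda>x y. (x, y) \<in> edges G) p \<and>
     (if u = v then distinct (tl p) else distinct p) \<and>
     set (butlast (tl p)) \<inter> S = {}"

definition branch_product :: "'v wgraph \<Rightarrow> 'v list \<Rightarrow> ratfun" where
  "branch_product G p = weight G (p ! 0) (p ! 1) *
     (\<Prod>k = 1..<length p - 1. weight G (p ! k) (p ! Suc k) / (lam - weight G (p ! k) (p ! k)))"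

definition reduction :: "'v wgraph \<Rightarrow> 'v set \<Rightarrow> 'v wgraph" where
  "reduction G S = \<lparr>verts = S,
     weight = (\<lambda>u v. if u \<in> S \<and> v \<in> S
       then (\<Sum>p \<in> {p. branch G S u v p}. branch_product G p) else 0)\<rparr>"

fun reduction_seq :: "'v wgraph \<Rightarrow> 'v set list \<Rightarrow> bool" where
  "reduction_seq G [] \<longleftrightarrow> True"
| "reduction_seq G (S # Ss) \<longleftrightarrow> structural_set G S \<and> reduction_seq (reduction G S) Ss"

text \<open>
  The graph obtained from a sequence of reductions with final vertex set \<open>V\<close>; for graphs in
  \<open>graphs_pi\<close> and nonempty \<open>V \<subseteq> verts G\<close> it exists and is unique.
\<close>

definition reduce_to :: "'v wgraph \<Rightarrow> 'v set \<Rightarrow> 'v wgraph" where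
  "reduce_to G V = (THE H. \<exists>Ss. Ss \<noteq> [] \<and> reduction_seq G Ss \<and> last Ss = V \<and>
     H = foldl reduction G Ss)"


section \<open>The entries of the polynomial extension are polynomials\<close>

lemma to_fract_denom_mult: "to_fract (denom f) * f = to_fract (numer f)"
proof -
  have "f = quot_to_fract (quot_of_fract f)" by simp
  then have f: "f = Fract (numer f) (denom f)"
    unfolding quot_to_fract_def numer_def denom_def by (simp add: case_prod_unfold)
  have "denom f \<noteq> 0" unfolding denom_def by simp
  then have "to_fract (denom f) * Fract (numer f) (denom f) = to_fract (numer f)"
    by (simp add: to_fract_def eq_fract)
  with f show ?thesis by simp
qed

lemma denom_to_fract [simp]: "denom (to_fract p) = 1"
  by (simp add: denom_def)

lemma row_denom_mult:
  assumes "finite (verts G)" "v \<in> verts G"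
  obtains r where "to_fract (row_denom G u) * weight G u v = to_fract r"
proof -
  have "denom (weight G u v) dvd row_denom G u"
    unfolding row_denom_def using assms by (intro dvd_prodI) auto
  then obtain c where c: "row_denom G u = c * denom (weight G u v)"
    by (metis dvdE mult.commute)
  have "to_fract (row_denom G u) * weight G u v = to_fract (c * numer (weight G u v))"
    unfolding c by (simp add: mult.assoc to_fract_denom_mult)
  then show thesis by (rule that)
qed

lemma denom_poly_ext_weight:
  assumes "finite (verts G)"
  shows "denom (weight (poly_ext G) u v) = 1"
proof (cases "u \<in> verts G \<and> v \<in> verts G")
  case True
  then obtain r where r: "to_fract (row_denom G u) * weight G u v = to_fract r"
    using row_denom_mult[OF assms] by blast
  have "to_fract (row_denom G u) * (weight G u v - lam) + lam
      = to_fract (r - row_denom G u * [:0, 1:] + [:0, 1:])"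
    by (simp only: right_diff_distrib r lam_def to_fract_add to_fract_diff to_fract_mult)
  with True r have "weight (poly_ext G) u v =
      to_fract (if u = v then r - row_denom G u * [:0, 1:] + [:0, 1:] else r)"
    unfolding poly_ext_def by (cases "u = v") (simp_all only: wgraph.simps if_True if_False simp_thms)
  then show ?thesis by (simp only: denom_to_fract)
next
  case False
  then have "weight (poly_ext G) u v = to_fract 0" by (auto simp: poly_ext_def)
  then show ?thesis by (simp only: denom_to_fract)
qed

end

theory Submission
  imports Defs
begin

text \<open>
  Write \<open>\<rho>\<^sub>u\<^sub>v = \<omega>(u,v) / (\<lambda> - \<omega>(u,u))\<close> and \<open>\<sigma>\<^sub>u = \<Sum>\<^sub>v |\<rho>\<^sub>u\<^sub>v(z)|\<close>. A point \<open>z\<close> lies outside the region iff all off-diagonal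
  weights and all \<open>1 / (\<lambda> - \<omega>(u,u))\<close> are regular at \<open>z\<close> and \<open>\<sigma>\<^sub>u \<sigma>\<^sub>v < 1\<close> for \<open>u \<noteq> v\<close>. Removing a vertex \<open>t\<close>
  replaces \<open>\<rho>\<^sub>u\<^sub>v\<close> by \<open>(\<rho>\<^sub>u\<^sub>v + \<rho>\<^sub>u\<^sub>t \<rho>\<^sub>t\<^sub>v) / (1 - \<rho>\<^sub>u\<^sub>t \<rho>\<^sub>t\<^sub>u)\<close>, and this preserves both conditions, also at poles of the
  weights. Any reduction can be done one vertex at a time: the reduced graph does not depend on
  the sequence, because it acts on vectors on \<open>V\<close> as the given matrix acts on their unique extensions
  that satisfy the eigenvector equation off \<open>V\<close>; the extension is unique because \<open>\<lambda>\<close> is not a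
  quotient with \<open>deg p \<le> deg q\<close> while all weights are.
\<close>

section \<open>Rational functions regular at a point\<close>

text \<open>At a pole \<open>eval_ratfun\<close> divides by zero and returns 0, so evaluation is
  compatible with the field operations only at points with this property.\<close>

definition regular :: "complex \<Rightarrow> ratfun \<Rightarrow> bool" where
  "regular z f \<longleftrightarrow> poly (denom f) z \<noteq> 0"

lemma denom_nonzero [simp]: "denom f \<noteq> 0"
  by (simp add: denom_def)

lemma numer_eq_0_iff [simp]: "numer f = 0 \<longleftrightarrow> f = 0"
  by (simp add: numer_def)

lemma numer_0 [simp]: "numer 0 = 0"
  by simp

lemma ratfun_eq_quotient: "f = to_fract (numer f) / to_fract (denom f)"
  using to_fract_denom_mult[of f] by (simp add: field_simps)

lemma divide_eq_quotient:
  "f / g = to_fract (numer f * denom g) / to_fract (denom f * numer g)"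
proof -
  have "f / g = (to_fract (numer f) / to_fract (denom f)) / (to_fract (numer g) / to_fract (denom g))"
    by (simp only: ratfun_eq_quotient[symmetric])
  then show ?thesis by simp
qed

lemma coprime_numer_denom: "coprime (numer f) (denom f)"
  unfolding numer_def denom_def by (rule coprime_quot_of_fract)

text \<open>Cross-multiplying and using that \<open>numer f\<close> and \<open>denom f\<close> are
  coprime, \<open>denom f\<close> must divide \<open>q\<close>. This allows regularity, values and
  degrees to be read off fractions that are not in lowest terms.\<close>

lemma quotient_numer_denom:
  assumes "q \<noteq> 0" "f = to_fract p / to_fract q"
  obtains c where "c \<noteq> 0" "q = c * denom f" "p = c * numer f"
proof -
  have "to_fract p / to_fract q = to_fract (numer f) / to_fract (denom f)"
    using assms(2) ratfun_eq_quotient[of f] by simp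
  then have "to_fract (p * denom f) = to_fract (numer f * q)"
    using assms(1) by (simp add: field_simps)
  then have eq: "p * denom f = numer f * q" by (simp only: to_fract_eq_iff)
  then have "denom f dvd numer f * q" by (metis dvdI mult.commute)
  then have "denom f dvd q"
    using coprime_numer_denom[of f] by (simp add: coprime_dvd_mult_right_iff coprime_commute)
  then obtain c where c: "q = c * denom f" by (metis dvdE mult.commute)
  with eq have "p * denom f = c * numer f * denom f" by (simp add: ac_simps)
  then have p: "p = c * numer f" by (simp only: mult_cancel_right denom_nonzero simp_thms)
  show thesis using assms(1) c by (intro that[OF _ c p]) simp
qed

lemma regular_eval_quotient:
  assumes "f = to_fract p / to_fract q" "poly q z \<noteq> 0"
  shows "regular z f" "eval_ratfun f z = poly p z / poly q z"
proof -
  from assms(2) have "q \<noteq> 0" by auto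
  then obtain c where c: "q = c * denom f" "p = c * numer f"
    using quotient_numer_denom assms(1) by blast
  with assms(2) show "regular z f" "eval_ratfun f z = poly p z / poly q z"
    by (auto simp: regular_def eval_ratfun_def)
qed

lemma regularE:
  assumes "regular z f"
  obtains p q where "f = to_fract p / to_fract q" "poly q z \<noteq> 0"
    "eval_ratfun f z = poly p z / poly q z"
  using that[OF ratfun_eq_quotient] assms by (simp add: regular_def eval_ratfun_def)

lemma regular_to_fract [simp]: "regular z (to_fract p)"
  by (simp add: regular_def)

lemma eval_to_fract [simp]: "eval_ratfun (to_fract p) z = poly p z"
  using regular_eval_quotient(2)[of "to_fract p" p 1 z] by simp

lemma regular_lam [simp]: "regular z lam" and eval_lam [simp]: "eval_ratfun lam z = z"
  by (simp_all add: lam_def)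

lemma regular_1 [simp]: "regular z 1" and eval_1 [simp]: "eval_ratfun 1 z = 1"
  using regular_to_fract[of z 1] eval_to_fract[of 1 z] by simp_all

lemma regular_0 [simp]: "regular z 0" and eval_0 [simp]: "eval_ratfun 0 z = 0"
  using regular_to_fract[of z 0] eval_to_fract[of 0 z] by simp_all

section \<open>Evaluation at a regular point and the field operations\<close>

lemma
  assumes "regular z f" "regular z g"
  shows regular_add: "regular z (f + g)"
    and eval_add: "eval_ratfun (f + g) z = eval_ratfun f z + eval_ratfun g z"
proof -
  obtain p q where f: "f = to_fract p / to_fract q" "poly q z \<noteq> 0"
    "eval_ratfun f z = poly p z / poly q z" using assms(1) by (rule regularE)
  obtain r s where g: "g = to_fract r / to_fract s" "poly s z \<noteq> 0"
    "eval_ratfun g z = poly r z / poly s z" using assms(2) by (rule regularE)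
  have nz: "q \<noteq> 0" "s \<noteq> 0" using f(2) g(2) by auto
  then have *: "f + g = to_fract (p * s + r * q) / to_fract (q * s)"
    by (simp add: f(1) g(1) add_frac_eq)
  have nz': "poly (q * s) z \<noteq> 0" using f(2) g(2) by simp
  show "regular z (f + g)" by (rule regular_eval_quotient(1)[OF * nz'])
  show "eval_ratfun (f + g) z = eval_ratfun f z + eval_ratfun g z"
    unfolding regular_eval_quotient(2)[OF * nz'] f(3) g(3) using f(2) g(2) by (simp add: add_frac_eq)
qed

lemma
  assumes "regular z f" "regular z g"
  shows regular_mult: "regular z (f * g)"
    and eval_mult: "eval_ratfun (f * g) z = eval_ratfun f z * eval_ratfun g z"
proof -
  obtain p q where f: "f = to_fract p / to_fract q" "poly q z \<noteq> 0"
    "eval_ratfun f z = poly p z / poly q z" using assms(1) by (rule regularE)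
  obtain r s where g: "g = to_fract r / to_fract s" "poly s z \<noteq> 0"
    "eval_ratfun g z = poly r z / poly s z" using assms(2) by (rule regularE)
  have *: "f * g = to_fract (p * r) / to_fract (q * s)"
    by (simp add: f(1) g(1))
  have nz': "poly (q * s) z \<noteq> 0" using f(2) g(2) by simp
  show "regular z (f * g)" by (rule regular_eval_quotient(1)[OF * nz'])
  show "eval_ratfun (f * g) z = eval_ratfun f z * eval_ratfun g z"
    unfolding regular_eval_quotient(2)[OF * nz'] f(3) g(3) by simp
qed

lemma
  assumes "regular z f"
  shows regular_uminus: "regular z (- f)"
    and eval_uminus: "eval_ratfun (- f) z = - eval_ratfun f z"
proof -
  have "- f = to_fract (- 1) * f" by simp
  then show "regular z (- f)" "eval_ratfun (- f) z = - eval_ratfun f z"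
    by (simp_all only: regular_mult eval_mult regular_to_fract assms eval_to_fract) simp_all
qed

lemma
  assumes "regular z f" "regular z g"
  shows regular_diff: "regular z (f - g)"
    and eval_diff: "eval_ratfun (f - g) z = eval_ratfun f z - eval_ratfun g z"
  using regular_add[OF assms(1) regular_uminus[OF assms(2)]]
    eval_add[OF assms(1) regular_uminus[OF assms(2)]]
  by (simp_all add: eval_uminus[OF assms(2)])

lemma
  assumes "regular z f" "eval_ratfun f z \<noteq> 0"
  shows regular_inverse: "regular z (inverse f)"
    and eval_inverse: "eval_ratfun (inverse f) z = inverse (eval_ratfun f z)"
proof -
  obtain p q where f: "f = to_fract p / to_fract q" "poly q z \<noteq> 0"
    "eval_ratfun f z = poly p z / poly q z" using assms(1) by (rule regularE)
  have *: "inverse f = to_fract q / to_fract p" by (simp add: f(1))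
  have nz: "poly p z \<noteq> 0" using assms(2) f(3) by auto
  show "regular z (inverse f)" by (rule regular_eval_quotient(1)[OF * nz])
  show "eval_ratfun (inverse f) z = inverse (eval_ratfun f z)"
    unfolding regular_eval_quotient(2)[OF * nz] f(3) by simp
qed


section \<open>Proper rational functions\<close>

text \<open>These are the functions that are finite at infinity, a valuation ring in the field of
  rational functions.\<close>

definition proper :: "ratfun \<Rightarrow> bool" where
  "proper f \<longleftrightarrow> degree (numer f) \<le> degree (denom f)"

lemma proper_quotient_iff:
  assumes "q \<noteq> 0"
  shows "proper (to_fract p / to_fract q) \<longleftrightarrow> degree p \<le> degree q"
proof -
  define f where "f = to_fract p / to_fract q"
  obtain c where c: "c \<noteq> 0" "q = c * denom f" "p = c * numer f"
    using quotient_numer_denom[OF assms f_def] by blast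
  have "degree q = degree c + degree (denom f)" using c by (simp add: degree_mult_eq)
  moreover have "degree p = (if numer f = 0 then 0 else degree c + degree (numer f))"
    using c by (simp add: degree_mult_eq)
  ultimately show ?thesis unfolding f_def[symmetric] proper_def by auto
qed

lemma properE:
  assumes "proper f"
  obtains p q where "f = to_fract p / to_fract q" "q \<noteq> 0" "degree p \<le> degree q"
  using that[OF ratfun_eq_quotient] assms by (simp add: proper_def)

lemma proper_0 [simp]: "proper 0"
  using proper_quotient_iff[of 1 0] by simp

lemma proper_add:
  assumes "proper f" "proper g"
  shows "proper (f + g)"
proof -
  obtain p q where f: "f = to_fract p / to_fract q" "q \<noteq> 0" "degree p \<le> degree q"
    using assms(1) by (rule properE)
  obtain r s where g: "g = to_fract r / to_fract s" "s \<noteq> 0" "degree r \<le> degree s"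
    using assms(2) by (rule properE)
  have "f + g = to_fract (p * s + r * q) / to_fract (q * s)"
    using f(2) g(2) by (simp add: f(1) g(1) add_frac_eq)
  moreover have "degree (p * s + r * q) \<le> degree (q * s)"
    using f g degree_mult_le[of p s] degree_mult_le[of r q]
    by (intro degree_add_le) (simp_all add: degree_mult_eq)
  ultimately show ?thesis using f(2) g(2) by (simp only: proper_quotient_iff mult_eq_0_iff simp_thms)
qed

lemma proper_mult:
  assumes "proper f" "proper g"
  shows "proper (f * g)"
proof -
  obtain p q where f: "f = to_fract p / to_fract q" "q \<noteq> 0" "degree p \<le> degree q"
    using assms(1) by (rule properE)
  obtain r s where g: "g = to_fract r / to_fract s" "s \<noteq> 0" "degree r \<le> degree s"
    using assms(2) by (rule properE)
  have "f * g = to_fract (p * r) / to_fract (q * s)" by (simp add: f(1) g(1))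
  moreover have "degree (p * r) \<le> degree (q * s)"
    using f g degree_mult_le[of p r] by (simp add: degree_mult_eq)
  ultimately show ?thesis using f(2) g(2) by (simp only: proper_quotient_iff mult_eq_0_iff simp_thms)
qed

lemma proper_sum: "(\<And>x. x \<in> A \<Longrightarrow> proper (f x)) \<Longrightarrow> proper (sum f A)"
  by (induction A rule: infinite_finite_induct) (auto intro: proper_add)

lemma not_proper_lam: "\<not> proper lam"
  using proper_quotient_iff[of 1 "[:0, 1:]"] by (simp add: lam_def)

text \<open>With \<open>f = p / q\<close>, the numerator \<open>\<lambda> q - p\<close> of
  \<open>lam - f\<close> has degree exactly one more than \<open>q\<close>, since \<open>p\<close>
  is too small to cancel the leading term. So the difference is nonzero and its inverse is
  proper.\<close>

lemma proper_inverse_lam_diff: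
  assumes "proper f"
  shows "proper (inverse (lam - f))"
proof -
  obtain p q where f: "f = to_fract p / to_fract q" "q \<noteq> 0" "degree p \<le> degree q"
    using assms by (rule properE)
  let ?n = "[:0, 1:] * q - p"
  have deg: "degree ?n = Suc (degree q)"
    using f by (subst diff_conv_add_uminus, subst degree_add_eq_left) (auto simp: degree_mult_eq)
  have "lam - f = to_fract ?n / to_fract q"
    using f(2) unfolding f(1) lam_def
    by (simp only: to_fract_diff to_fract_mult diff_divide_distrib) simp
  then have "inverse (lam - f) = to_fract q / to_fract ?n" by simp
  moreover have "?n \<noteq> 0" using deg by auto
  moreover have "degree q \<le> degree ?n" using deg by simp
  ultimately show ?thesis by (simp only: proper_quotient_iff simp_thms)
qed

lemma exists_proper_normalizer:
  assumes "finite A" "\<exists>t\<in>A. y t \<noteq> (0 :: ratfun)"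
  shows "\<exists>t\<in>A. y t \<noteq> 0 \<and> (\<forall>s\<in>A. proper (y s / y t))"
proof -
  \<comment> \<open>This is minus the valuation at infinity. A nonzero entry maximizing it has a
    proper quotient with every entry of the family.\<close>
  define d where "d f = int (degree (numer f)) - int (degree (denom f))" for f
  let ?B = "{t \<in> A. y t \<noteq> 0}"
  have "finite ?B" "?B \<noteq> {}" using assms by auto
  obtain t where t: "t \<in> ?B" and max: "\<And>s. s \<in> ?B \<Longrightarrow> d (y s) \<le> d (y t)"
  proof (rule obtains_MAX[OF \<open>finite ?B\<close> \<open>?B \<noteq> {}\<close>, of "\<lambda>t. d (y t)"])
    fix t assume t: "t \<in> ?B" and "(MAX s\<in>?B. d (y s)) = d (y t)"
    moreover have "d (y s) \<le> (MAX s\<in>?B. d (y s))" if "s \<in> ?B" for s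
      using \<open>finite ?B\<close> that by (intro Max_ge) auto
    ultimately show thesis by (intro that[OF t]) simp
  qed
  have num: "numer (y t) \<noteq> 0" using t by simp
  have "proper (y s / y t)" if "s \<in> A" for s
  proof (cases "y s = 0")
    case False
    then have num': "numer (y s) \<noteq> 0" by simp
    have "d (y s) \<le> d (y t)" using max that False by simp
    then have "degree (numer (y s) * denom (y t)) \<le> degree (denom (y s) * numer (y t))"
      using num num' by (simp add: d_def degree_mult_eq)
    moreover have "y s / y t = to_fract (numer (y s) * denom (y t)) / to_fract (denom (y s) * numer (y t))"
      by (rule divide_eq_quotient)
    ultimately show ?thesis using num by (simp only: proper_quotient_iff mult_eq_0_iff denom_nonzero simp_thms)
  qed simp
  with t show ?thesis by (intro bexI[of _ t]) simp_all
qed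

text \<open>\<open>\<lambda> - W\<close> is invertible for a matrix \<open>W\<close> of proper functions: dividing an eigenvector equation
  by an entry of maximal degree would make \<open>\<lambda>\<close> proper.\<close>

lemma proper_eigenvector_zero:
  assumes "finite A" and W: "\<And>s t. s \<in> A \<Longrightarrow> t \<in> A \<Longrightarrow> proper (W s t)"
    and eq: "\<And>s. s \<in> A \<Longrightarrow> (\<Sum>t\<in>A. W s t * y t) = lam * y s"
    and "s \<in> A"
  shows "y s = 0"
proof (rule ccontr)
  assume "y s \<noteq> 0"
  then obtain t where t: "t \<in> A" "y t \<noteq> 0" "\<forall>s\<in>A. proper (y s / y t)"
    using exists_proper_normalizer[OF assms(1), of y] \<open>s \<in> A\<close> by blast
  have "proper (\<Sum>s\<in>A. W t s * (y s / y t))"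
    using W t by (intro proper_sum proper_mult) auto
  moreover have "lam = (\<Sum>s\<in>A. W t s * y s) / y t" using eq[OF t(1)] t(2) by simp
  ultimately show False using not_proper_lam by (simp add: sum_divide_distrib)
qed


section \<open>The complement of the Brauer-type region\<close>

text \<open>The loop weight itself may have a pole at \<open>z\<close>; only the inverse of
  \<open>lam - weight G u u\<close> has to be regular. The case \<open>weight G u u = lam\<close> is
  excluded separately because \<open>inverse 0 = 0\<close> would count as regular.\<close>

definition row_regular :: "complex \<Rightarrow> 'v wgraph \<Rightarrow> 'v \<Rightarrow> bool" where
  "row_regular z G u \<longleftrightarrow> (\<forall>v\<in>verts G - {u}. regular z (weight G u v)) \<and>
     weight G u u \<noteq> lam \<and> regular z (inverse (lam - weight G u u))"

text \<open>Off the diagonal these are the entries of the Jacobi iteration matrix of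
  \<open>lam - M(G)\<close>.\<close>

definition ratio :: "'v wgraph \<Rightarrow> 'v \<Rightarrow> 'v \<Rightarrow> ratfun" where
  "ratio G u v = weight G u v / (lam - weight G u u)"

definition ratio_sum :: "'v wgraph \<Rightarrow> complex \<Rightarrow> 'v \<Rightarrow> real" where
  "ratio_sum G z u = (\<Sum>v\<in>verts G - {u}. cmod (eval_ratfun (ratio G u v) z))"

lemma row_regular_ratio: "row_regular z G u \<Longrightarrow> v \<in> verts G \<Longrightarrow> v \<noteq> u \<Longrightarrow> regular z (ratio G u v)"
  by (simp add: row_regular_def ratio_def divide_inverse regular_mult)

lemma row_denom_nonzero: "row_denom G u \<noteq> 0"
  by (cases "finite (verts G)") (simp_all add: row_denom_def)

text \<open>The summand \<open>lam\<close> on the diagonal of the extension cancels, so the diagonal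
  of \<open>lam\<close> minus the extended matrix is the original one scaled by the row denominator,
  like the other entries of the row up to sign.\<close>

lemma diag_ext_poly:
  assumes "finite (verts G)" "u \<in> verts G"
  obtains N where "to_fract (row_denom G u) * (lam - weight G u u) = to_fract N"
    "\<And>z. z - eval_ratfun (weight (poly_ext G) u u) z = poly N z"
proof -
  obtain r where r: "to_fract (row_denom G u) * weight G u u = to_fract r"
    using row_denom_mult[OF assms] .
  define N where "N = row_denom G u * [:0, 1:] - r"
  have N: "to_fract (row_denom G u) * (lam - weight G u u) = to_fract N"
    by (simp only: N_def right_diff_distrib r to_fract_diff to_fract_mult lam_def)
  have "to_fract (row_denom G u) * (weight G u u - lam) + lam = lam - to_fract N"
    unfolding N[symmetric] by (simp add: algebra_simps)
  then have "weight (poly_ext G) u u = lam - to_fract N"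
    using assms(2) by (simp add: poly_ext_def)
  then show thesis using N by (intro that[of N]) (simp_all add: eval_diff)
qed

text \<open>If \<open>denom (weight G u v)\<close> vanishes at \<open>z\<close> for some \<open>v \<noteq> u\<close>, then it divides the diagonal
  polynomial; this is why a nonvanishing diagonal excludes poles off the diagonal.\<close>

lemma
  assumes fin: "finite (verts G)" "u \<in> verts G"
    and N: "to_fract (row_denom G u) * (lam - weight G u u) = to_fract N" "poly N z \<noteq> 0"
  shows row_regularI: "row_regular z G u"
    and eval_ratio: "v \<in> verts G \<Longrightarrow>
      eval_ratfun (ratio G u v) z = eval_ratfun (to_fract (row_denom G u) * weight G u v) z / poly N z"
proof -
  have N0: "N \<noteq> 0" using N(2) by auto
  have w: "weight G u u \<noteq> lam" using N(1) N0 by auto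
  have inv: "inverse (lam - weight G u u) = to_fract (row_denom G u) / to_fract N"
    unfolding N(1)[symmetric] using w row_denom_nonzero[of G u] by (simp add: field_simps)
  have "regular z (weight G u v)" if v: "v \<in> verts G - {u}" for v
  proof -
    define K where "K = (\<Prod>v\<in>verts G - {v} - {u}. denom (weight G u v))"
    have "row_denom G u = denom (weight G u v) * (denom (weight G u u) * K)"
      unfolding row_denom_def K_def
      using prod.remove[of "verts G" v "\<lambda>v. denom (weight G u v)"]
        prod.remove[of "verts G - {v}" u "\<lambda>v. denom (weight G u v)"] v fin by auto
    then have "to_fract N = to_fract (denom (weight G u v)) * to_fract K *
        (to_fract (denom (weight G u u)) * lam - to_fract (denom (weight G u u)) * weight G u u)"
      unfolding N(1)[symmetric] by (simp add: algebra_simps)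
    also have "\<dots> = to_fract (denom (weight G u v) * K *
        (denom (weight G u u) * [:0, 1:] - numer (weight G u u)))"
      by (simp only: to_fract_denom_mult lam_def to_fract_mult to_fract_diff)
    finally have "N = denom (weight G u v) * K *
        (denom (weight G u u) * [:0, 1:] - numer (weight G u u))"
      by (simp only: to_fract_eq_iff)
    with N(2) show ?thesis unfolding regular_def by auto
  qed
  with w regular_eval_quotient(1)[OF inv N(2)] show "row_regular z G u"
    by (simp add: row_regular_def)
  assume "v \<in> verts G"
  then obtain r where r: "to_fract (row_denom G u) * weight G u v = to_fract r"
    using row_denom_mult[OF fin(1)] by blast
  have "ratio G u v = to_fract r / to_fract N"
    unfolding ratio_def divide_inverse inv r[symmetric] by simp
  from regular_eval_quotient(2)[OF this N(2)]
  show "eval_ratfun (ratio G u v) z =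
      eval_ratfun (to_fract (row_denom G u) * weight G u v) z / poly N z"
    unfolding r by simp
qed

text \<open>\<open>N\<close> factors as \<open>K * n\<close>, where \<open>K\<close> collects the
  off-diagonal denominators and does not vanish at \<open>z\<close>. A zero of \<open>N\<close> is
  thus a zero of \<open>n\<close>; regularity of \<open>inverse (lam - f)\<close>, which is
  \<open>denom f / n\<close>, then makes \<open>denom f\<close> vanish at \<open>z\<close>, hence
  also \<open>numer f\<close>, against coprimality.\<close>

lemma row_regularD:
  assumes fin: "finite (verts G)" "u \<in> verts G"
    and N: "to_fract (row_denom G u) * (lam - weight G u u) = to_fract N"
    and reg: "row_regular z G u"
  shows "poly N z \<noteq> 0"
proof
  assume N0: "poly N z = 0"
  define K where "K = (\<Prod>v\<in>verts G - {u}. denom (weight G u v))"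
  define f where "f = weight G u u"
  define n where "n = denom f * [:0, 1:] - numer f"
  have K0: "poly K z \<noteq> 0"
    using reg fin unfolding K_def by (auto simp: poly_prod row_regular_def regular_def)
  have "row_denom G u = denom f * K"
    unfolding row_denom_def K_def f_def using fin by (simp add: prod.remove)
  then have "to_fract N = to_fract K * (to_fract (denom f) * lam - to_fract (denom f) * f)"
    unfolding N[symmetric] by (simp add: algebra_simps f_def)
  also have "\<dots> = to_fract (K * n)"
    by (simp only: n_def to_fract_denom_mult lam_def to_fract_mult to_fract_diff)
  finally have "N = K * n" by (simp only: to_fract_eq_iff)
  with N0 K0 have n0: "poly n z = 0" by simp
  have inv: "inverse (lam - f) * to_fract n = to_fract (denom f)"
  proof -
    have "to_fract n = to_fract (denom f) * (lam - f)"
      by (simp only: n_def to_fract_denom_mult lam_def to_fract_mult to_fract_diff right_diff_distrib)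
    moreover have "lam - f \<noteq> 0" using reg by (auto simp: row_regular_def f_def)
    ultimately show ?thesis by simp
  qed
  have "regular z (inverse (lam - f))" using reg by (simp add: row_regular_def f_def)
  from eval_mult[OF this regular_to_fract[of z n]] have "poly (denom f) z = 0"
    unfolding inv by (simp add: n0)
  moreover from this n0 have "poly (numer f) z = 0" by (simp add: n_def)
  ultimately have "[:- z, 1:] dvd numer f" "[:- z, 1:] dvd denom f"
    by (simp_all add: poly_eq_0_iff_dvd)
  then have "is_unit [:- z, 1:]" using coprime_numer_denom by (rule coprime_common_divisor[rotated])
  then show False by (simp add: is_unit_iff_degree)
qed

text \<open>Dividing the inequality for \<open>u\<close> and \<open>v\<close> by the two diagonal
  polynomials turns row sums into ratio sums. These polynomials are nonzero at \<open>z\<close>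
  exactly when the rows are regular there.\<close>

lemma not_in_brauer_region_iff:
  assumes fin: "finite (verts G)" and card: "card (verts G) \<ge> 2"
  shows "z \<notin> brauer_region G \<longleftrightarrow> (\<forall>u\<in>verts G. row_regular z G u) \<and>
    (\<forall>u\<in>verts G. \<forall>v\<in>verts G - {u}. ratio_sum G z u * ratio_sum G z v < 1)"
proof -
  have "\<exists>N. \<forall>u\<in>verts G. to_fract (row_denom G u) * (lam - weight G u u) = to_fract (N u) \<and>
      z - eval_ratfun (weight (poly_ext G) u u) z = poly (N u) z"
    by (intro bchoice ballI) (metis diag_ext_poly fin)
  then obtain N where N: "\<And>u. u \<in> verts G \<Longrightarrow>
      to_fract (row_denom G u) * (lam - weight G u u) = to_fract (N u)"
    "\<And>u. u \<in> verts G \<Longrightarrow> z - eval_ratfun (weight (poly_ext G) u u) z = poly (N u) z"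
    by blast
  have row: "abs_row_sum (poly_ext G) u z = cmod (poly (N u) z) * ratio_sum G z u"
    if "u \<in> verts G" "poly (N u) z \<noteq> 0" for u
  proof -
    have "abs_row_sum (poly_ext G) u z
        = (\<Sum>v\<in>verts G - {u}. cmod (poly (N u) z) * cmod (eval_ratfun (ratio G u v) z))"
      unfolding abs_row_sum_def
    proof (rule sum.cong)
      show "verts (poly_ext G) - {u} = verts G - {u}" by (simp add: poly_ext_def)
      fix v assume v: "v \<in> verts G - {u}"
      have "weight (poly_ext G) u v = to_fract (row_denom G u) * weight G u v"
        using that v by (auto simp: poly_ext_def)
      then show "cmod (eval_ratfun (weight (poly_ext G) u v) z)
          = cmod (poly (N u) z) * cmod (eval_ratfun (ratio G u v) z)"
        using eval_ratio[OF fin that(1) N(1)[OF that(1)] that(2)] v that(2)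
        by (simp add: norm_divide)
    qed
    then show ?thesis by (simp add: ratio_sum_def sum_distrib_left)
  qed
  have out: "z \<notin> brauer_region G \<longleftrightarrow> (\<forall>u\<in>verts G. \<forall>v\<in>verts G - {u}.
      abs_row_sum (poly_ext G) u z * abs_row_sum (poly_ext G) v z
        < cmod (poly (N u) z) * cmod (poly (N v) z))"
    unfolding brauer_region_def using N(2) by (auto simp: not_le)
  have scale: "abs_row_sum (poly_ext G) u z * abs_row_sum (poly_ext G) v z
        < cmod (poly (N u) z) * cmod (poly (N v) z) \<longleftrightarrow> ratio_sum G z u * ratio_sum G z v < 1"
    if "u \<in> verts G" "v \<in> verts G" "poly (N u) z \<noteq> 0" "poly (N v) z \<noteq> 0" for u v
  proof -
    have "0 < cmod (poly (N u) z) * cmod (poly (N v) z)" using that by simp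
    from mult_less_cancel_left_pos[OF this, of "ratio_sum G z u * ratio_sum G z v" 1]
    show ?thesis unfolding row[OF that(1,3)] row[OF that(2,4)] by (simp add: ac_simps)
  qed
  \<comment> \<open>A strict inequality with a nonnegative left side forces both factors on the
    right to be nonzero. At least two vertices are needed for \<open>u\<close> to have a partner
    \<open>v\<close>.\<close>
  have nz: "poly (N u) z \<noteq> 0" if "z \<notin> brauer_region G" "u \<in> verts G" for u
  proof -
    have "verts G - {u} \<noteq> {}"
    proof
      assume "verts G - {u} = {}"
      then have "verts G \<subseteq> {u}" by auto
      from card_mono[OF _ this] card show False by simp
    qed
    then obtain v where v: "v \<in> verts G - {u}" by blast
    have "0 \<le> abs_row_sum (poly_ext G) u z * abs_row_sum (poly_ext G) v z"
      by (simp add: abs_row_sum_def sum_nonneg)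
    also have "\<dots> < cmod (poly (N u) z) * cmod (poly (N v) z)" using out that v by blast
    finally show ?thesis by auto
  qed
  show ?thesis
  proof
    assume z: "z \<notin> brauer_region G"
    then show "(\<forall>u\<in>verts G. row_regular z G u) \<and>
      (\<forall>u\<in>verts G. \<forall>v\<in>verts G - {u}. ratio_sum G z u * ratio_sum G z v < 1)"
      using row_regularI[OF fin _ N(1) nz] out scale nz by simp
  next
    assume r: "(\<forall>u\<in>verts G. row_regular z G u) \<and>
      (\<forall>u\<in>verts G. \<forall>v\<in>verts G - {u}. ratio_sum G z u * ratio_sum G z v < 1)"
    then have "poly (N u) z \<noteq> 0" if "u \<in> verts G" for u
      using row_regularD[OF fin that N(1)[OF that]] that by blast
    with r scale show "z \<notin> brauer_region G" unfolding out by simp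
  qed
qed


section \<open>Eliminating one vertex\<close>

text \<open>Here \<open>si\<close>, \<open>sk\<close>, \<open>st\<close> are ratio sums of rows
  \<open>i\<close>, \<open>k\<close> and of the vertex \<open>t\<close> to be removed,
  \<open>xi\<close>, \<open>xk\<close> the moduli of the ratios into \<open>t\<close>, and
  \<open>yi\<close>, \<open>yk\<close> those out of \<open>t\<close>. The factors on the left bound
  the new row sums before normalization, those on the right bound the new denominators from
  below.\<close>

lemma pair_product_less_aux:
  fixes si sk st xi xk yi yk :: real
  assumes xi: "0 \<le> xi" "xi \<le> si" and xk: "0 \<le> xk" "xk \<le> sk"
    and y: "0 \<le> yi" "0 \<le> yk" "yi + yk \<le> st"
    and s: "si * sk < 1" "si * st < 1" "sk * st < 1"
    and le: "si \<le> sk"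
  shows "(si - xi + xi * (st - yi)) * (sk - xk + xk * (st - yk)) < (1 - xi * yi) * (1 - xk * yk)"
proof -
  have st0: "0 \<le> st" using y by simp
  have R0: "0 \<le> si - xi + xi * (st - yi)" "0 \<le> sk - xk + xk * (st - yk)"
    using xi xk y by (auto intro!: add_nonneg_nonneg mult_nonneg_nonneg)
  have Pi: "0 < 1 - xi * yi"
    using mult_mono[of xi si yi st] xi y st0 s(2) by auto
  show ?thesis
  \<comment> \<open>If \<open>st \<ge> 1\<close>, each factor on the left is already smaller than
    its own counterpart. If \<open>st < 1\<close>, the smaller sum satisfies \<open>si < 1\<close>;
    row \<open>i\<close> then gains a factor \<open>si\<close>, which compensates for row
    \<open>k\<close>.\<close>
  proof (cases "st < 1")
    case False
    have *: "s - x + x * (st - w) < 1 - x * w"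
      if "0 \<le> x" "x \<le> s" "s * st < 1" for x w s :: real
    proof -
      have "x * (st - 1) \<le> s * (st - 1)" using that False by (intro mult_right_mono) auto
      then show ?thesis using that by (simp add: algebra_simps)
    qed
    show ?thesis
      using *[of xi si yi] *[of xk sk yk] R0 xi xk s by (intro mult_strict_mono') auto
  next
    case True
    have si1: "si < 1"
    proof (rule ccontr)
      assume "\<not> si < 1"
      then have "1 * 1 \<le> si * sk" using le by (intro mult_mono) auto
      then show False using s by simp
    qed
    have si0: "0 \<le> si" and sk0: "0 \<le> sk" using xi xk by auto
    have A: "si - xi + xi * (st - yi) \<le> si * (1 - xi * yi)"
    proof -
      have "0 \<le> xi * ((1 - st) + yi * (1 - si))"
        using xi y True si1 by (intro mult_nonneg_nonneg add_nonneg_nonneg) auto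
      then show ?thesis by (simp add: algebra_simps)
    qed
    have B: "si * (sk - xk + xk * (st - yk)) < 1 - xk * yk"
    proof -
      \<comment> \<open>The difference of the two sides is \<open>1 - si * sk + xk * c\<close>,
        affine in \<open>xk\<close>. For negative \<open>c\<close> the worst case is
        \<open>xk = sk\<close> and \<open>yk = st\<close>, where it equals
        \<open>1 - sk * st\<close>.\<close>
      define c where "c = si * (1 - st) - (1 - si) * yk"
      have "0 < 1 - si * sk + xk * c"
      proof (cases "c \<ge> 0")
        case True
        then show ?thesis using s(1) mult_nonneg_nonneg[OF xk(1), of c] by linarith
      next
        case False
        then have "sk * c \<le> xk * c" using xk by (intro mult_right_mono_neg) auto
        moreover have "sk * ((1 - si) * yk) \<le> sk * ((1 - si) * st)"
          using sk0 si1 y by (intro mult_left_mono) auto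
        ultimately show ?thesis using s by (simp add: c_def algebra_simps)
      qed
      then show ?thesis by (simp add: c_def algebra_simps)
    qed
    have "(si - xi + xi * (st - yi)) * (sk - xk + xk * (st - yk))
        \<le> si * (1 - xi * yi) * (sk - xk + xk * (st - yk))"
      using A R0 by (intro mult_right_mono) auto
    also have "\<dots> = (1 - xi * yi) * (si * (sk - xk + xk * (st - yk)))" by simp
    also have "\<dots> < (1 - xi * yi) * (1 - xk * yk)"
      using B Pi by (intro mult_strict_left_mono) auto
    finally show ?thesis .
  qed
qed

lemma pair_product_less:
  fixes si sk st xi xk yi yk :: real
  assumes "0 \<le> xi" "xi \<le> si" "0 \<le> xk" "xk \<le> sk"
    and "0 \<le> yi" "0 \<le> yk" "yi + yk \<le> st"
    and "si * sk < 1" "si * st < 1" "sk * st < 1"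
  shows "(si - xi + xi * (st - yi)) * (sk - xk + xk * (st - yk)) < (1 - xi * yi) * (1 - xk * yk)"
  using pair_product_less_aux[of xi si xk sk yi yk st] pair_product_less_aux[of xk sk xi si yk yi st] assms
  by (cases "si \<le> sk") (simp_all add: ac_simps)

text \<open>The matrix \<open>lam - M(H)\<close> is the Schur complement of the entry of
  \<open>t\<close> in \<open>lam - M(G)\<close>. Describing \<open>H\<close> by its entries keeps
  branches out of the estimate. Outside the region of \<open>G\<close>, the conditions on pairs
  containing \<open>t\<close> keep the new denominators nonzero, and those on all pairs bound the
  new ratio sums.\<close>

lemma eliminate_vertex_brauer_region:
  assumes fin: "finite (verts G)" and t: "t \<in> verts G" and H: "verts H = verts G - {t}"
    and card: "card (verts H) \<ge> 2"
    and w: "\<And>u v. u \<in> verts H \<Longrightarrow> v \<in> verts H \<Longrightarrow>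
      weight H u v = weight G u v + weight G u t * weight G t v / (lam - weight G t t)"
  shows "brauer_region H \<subseteq> brauer_region G"
proof
  fix z assume zH: "z \<in> brauer_region H"
  have finH: "finite (verts H)" using fin H by simp
  have cardG: "card (verts G) \<ge> 2" using card card_Diff1_le[of "verts G" t] H by simp
  show "z \<in> brauer_region G"
  proof (rule ccontr)
    assume "z \<notin> brauer_region G"
    then have reg: "\<And>u. u \<in> verts G \<Longrightarrow> row_regular z G u"
      and less: "\<And>u v. u \<in> verts G \<Longrightarrow> v \<in> verts G \<Longrightarrow> u \<noteq> v \<Longrightarrow>
        ratio_sum G z u * ratio_sum G z v < 1"
      using not_in_brauer_region_iff[OF fin cardG] by auto
    define e where "e u v = eval_ratfun (ratio G u v) z" for u v
    define x where "x u = cmod (e u t)" for u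
    define y where "y u = cmod (e t u)" for u
    define s where "s u = ratio_sum G z u" for u
    have s_alt: "s u = (\<Sum>v\<in>verts G - {u}. cmod (e u v))" for u
      by (simp add: s_def ratio_sum_def e_def)
    have x_le: "x u \<le> s u" and y_le: "y u \<le> s t" if "u \<in> verts H" for u
      using that t fin unfolding s_alt x_def y_def H
      by (auto intro!: member_le_sum)
    have y2: "y u + y v \<le> s t" if "u \<in> verts H" "v \<in> verts H" "u \<noteq> v" for u v
    proof -
      have "(\<Sum>k\<in>{u, v}. cmod (e t k)) \<le> s t"
        unfolding s_alt using that fin H by (intro sum_mono2) auto
      then show ?thesis using that by (simp add: y_def)
    qed
    have ratio_reg: "regular z (ratio G u v)" if "u \<in> verts G" "v \<in> verts G" "u \<noteq> v" for u v
      using row_regular_ratio[OF reg[OF that(1)]] that by simp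
    have neq: "lam - weight G u u \<noteq> 0" if "u \<in> verts G" for u
      using reg[OF that] by (auto simp: row_regular_def)
    \<comment> \<open>Removing \<open>t\<close> multiplies \<open>lam - weight G u u\<close> by
      \<open>D u\<close>. At \<open>z\<close> it is nonzero because the product of the two ratios
      has modulus at most \<open>s u * s t\<close>, which is below 1.\<close>
    define D where "D u = 1 - ratio G u t * ratio G t u" for u
    have D_reg: "regular z (D u)" and D_eval: "eval_ratfun (D u) z = 1 - e u t * e t u"
      and xy: "x u * y u < 1" if u: "u \<in> verts H" for u
    proof -
      have ut: "u \<in> verts G" "u \<noteq> t" using u H by auto
      have "regular z (ratio G u t)" "regular z (ratio G t u)"
        using ratio_reg ut t by auto
      then show "regular z (D u)" "eval_ratfun (D u) z = 1 - e u t * e t u"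
        by (simp_all add: D_def e_def regular_diff regular_mult eval_diff eval_mult)
      have "x u * y u \<le> s u * s t"
        using x_le y_le u by (intro mult_mono) (auto simp: x_def y_def s_alt intro: sum_nonneg)
      also have "\<dots> < 1" using less ut t by (simp add: s_def)
      finally show "x u * y u < 1" .
    qed
    have cmod_D: "1 - x u * y u \<le> cmod (eval_ratfun (D u) z)" if "u \<in> verts H" for u
      using norm_triangle_ineq2[of 1 "e u t * e t u"]
      by (simp add: D_eval[OF that] x_def y_def norm_mult)
    have D_nz: "eval_ratfun (D u) z \<noteq> 0" if "u \<in> verts H" for u
      using cmod_D[OF that] xy[OF that] by auto
    have diag: "lam - weight H u u = (lam - weight G u u) * D u" if u: "u \<in> verts H" for u
    proof -
      have "lam - weight G u u \<noteq> 0" using neq u H by auto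
      then have "(lam - weight G u u) * (ratio G u t * ratio G t u)
          = weight G u t * weight G t u / (lam - weight G t t)"
        unfolding ratio_def by simp
      then show ?thesis unfolding w[OF u u] D_def right_diff_distrib[of _ 1] by simp
    qed
    have diag_nz: "lam - weight H u u \<noteq> 0" if u: "u \<in> verts H" for u
    proof -
      have "D u \<noteq> 0" using D_nz[OF u] by auto
      then show ?thesis using diag[OF u] neq u H by simp
    qed
    have row: "row_regular z H u" if u: "u \<in> verts H" for u
      unfolding row_regular_def
    proof (intro conjI ballI)
      have uG: "u \<in> verts G" "u \<noteq> t" using u H by auto
      show "weight H u u \<noteq> lam" using diag_nz[OF u] by auto
      show "regular z (inverse (lam - weight H u u))"
        unfolding diag[OF u] inverse_mult_distrib
        using reg[OF uG(1)] regular_inverse[OF D_reg[OF u] D_nz[OF u]]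
        by (intro regular_mult) (simp_all add: row_regular_def)
      fix v assume v: "v \<in> verts H - {u}"
      then have vG: "v \<in> verts G" "v \<noteq> u" "v \<noteq> t" using H by auto
      \<comment> \<open>Grouped in this way the detour through \<open>t\<close> is visibly regular,
        even where the loop weight at \<open>t\<close> has a pole.\<close>
      have "weight H u v = weight G u v + weight G u t * ratio G t v"
        using w[OF u] v by (simp add: ratio_def)
      then show "regular z (weight H u v)"
        using reg[OF uG(1)] uG vG t ratio_reg[of t v]
        by (simp add: row_regular_def regular_add regular_mult)
    qed
    have ratio_H: "ratio H u v = (ratio G u v + ratio G u t * ratio G t v) * inverse (D u)"
      if u: "u \<in> verts H" and v: "v \<in> verts H" for u v
    proof -
      show ?thesis unfolding ratio_def[of H] diag[OF u] w[OF u v]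
        by (simp add: ratio_def divide_inverse distrib_left distrib_right ac_simps)
    qed
    \<comment> \<open>Row \<open>u\<close> loses its entry at \<open>t\<close>, of size
      \<open>x u\<close>, and gains the detours through \<open>t\<close> to all vertices except
      \<open>u\<close>, of total size at most \<open>x u * (s t - y u)\<close>; the detour back to
      \<open>u\<close> goes into \<open>D u\<close>.\<close>
    have sum_H: "ratio_sum H z u * (1 - x u * y u) \<le> s u - x u + x u * (s t - y u)"
      if u: "u \<in> verts H" for u
    proof -
      have uG: "u \<in> verts G" "u \<noteq> t" using u H by auto
      let ?A = "verts G - {t} - {u}"
      have A_eq: "?A = verts G - {u} - {t}" by auto
      have bound: "cmod (eval_ratfun (ratio H u v) z) * cmod (eval_ratfun (D u) z)
          \<le> cmod (e u v) + x u * cmod (e t v)" if v: "v \<in> ?A" for v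
      proof -
        have r: "regular z (ratio G u v)" "regular z (ratio G u t)" "regular z (ratio G t v)"
          using ratio_reg uG v t by auto
        have "eval_ratfun (ratio H u v) z = (e u v + e u t * e t v) / eval_ratfun (D u) z"
          using ratio_H[OF u] v H r regular_inverse[OF D_reg[OF u] D_nz[OF u]]
            eval_inverse[OF D_reg[OF u] D_nz[OF u]]
          by (simp add: eval_mult eval_add regular_add regular_mult e_def divide_inverse)
        then have "cmod (eval_ratfun (ratio H u v) z) * cmod (eval_ratfun (D u) z)
            = cmod (e u v + e u t * e t v)"
          using D_nz[OF u] by (simp add: norm_divide)
        also have "\<dots> \<le> cmod (e u v) + x u * cmod (e t v)"
          using norm_triangle_ineq[of "e u v" "e u t * e t v"] by (simp add: norm_mult x_def)
        finally show ?thesis .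
      qed
      have "ratio_sum H z u * (1 - x u * y u) \<le> ratio_sum H z u * cmod (eval_ratfun (D u) z)"
        using cmod_D[OF u] by (intro mult_left_mono) (auto simp: ratio_sum_def intro: sum_nonneg)
      also have "\<dots> \<le> (\<Sum>v\<in>?A. cmod (e u v) + x u * cmod (e t v))"
        unfolding ratio_sum_def sum_distrib_right H by (intro sum_mono bound)
      also have "\<dots> = (\<Sum>v\<in>?A. cmod (e u v)) + x u * (\<Sum>v\<in>?A. cmod (e t v))"
        by (simp add: sum.distrib sum_distrib_left)
      also have "(\<Sum>v\<in>?A. cmod (e t v)) = s t - y u"
        using sum.remove[of "verts G - {t}" u "\<lambda>v. cmod (e t v)"] fin uG
        by (simp add: s_alt y_def)
      also have "(\<Sum>v\<in>?A. cmod (e u v)) = s u - x u"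
        using sum.remove[of "verts G - {u}" t "\<lambda>v. cmod (e u v)"] fin uG t
        by (simp add: s_alt x_def A_eq)
      finally show ?thesis .
    qed
    have "ratio_sum H z u * ratio_sum H z v < 1"
      if u: "u \<in> verts H" and v: "v \<in> verts H - {u}" for u v
    proof -
      have v': "v \<in> verts H" "u \<noteq> v" using v by auto
      have nn: "0 \<le> ratio_sum H z u" "0 \<le> ratio_sum H z v"
        by (auto simp: ratio_sum_def intro: sum_nonneg)
      have P: "0 < 1 - x u * y u" "0 < 1 - x v * y v" using xy u v' by auto
      have "(ratio_sum H z u * (1 - x u * y u)) * (ratio_sum H z v * (1 - x v * y v))
          \<le> (s u - x u + x u * (s t - y u)) * (s v - x v + x v * (s t - y v))"
        using nn P
        by (intro mult_mono sum_H u v' order_trans[OF _ sum_H[OF u]] mult_nonneg_nonneg) simp_all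
      also have "\<dots> < (1 - x u * y u) * (1 - x v * y v)"
      proof (rule pair_product_less)
        show "s u * s v < 1" "s u * s t < 1" "s v * s t < 1"
          using less u v' t H by (auto simp: s_def)
      qed (use x_le y2 u v' in \<open>auto simp: x_def y_def\<close>)
      finally have "(ratio_sum H z u * ratio_sum H z v) * ((1 - x u * y u) * (1 - x v * y v))
          < 1 * ((1 - x u * y u) * (1 - x v * y v))"
        by (simp add: ac_simps)
      then show ?thesis using P by (subst (asm) mult_less_cancel_right_pos) auto
    qed
    with row have "z \<notin> brauer_region H" using not_in_brauer_region_iff[OF finH card] by auto
    with zH show False by simp
  qed
qed


section \<open>Branch sums\<close>

text \<open>Unlike the weight of the reduction, this is not set to 0 for \<open>u\<close> outside
  \<open>S\<close>: removing the first vertex of a branch leaves one that starts outside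
  \<open>S\<close>.\<close>

definition branch_sum :: "'v wgraph \<Rightarrow> 'v set \<Rightarrow> 'v \<Rightarrow> 'v \<Rightarrow> ratfun" where
  "branch_sum G S u v = (\<Sum>p \<in> {p. branch G S u v p}. branch_product G p)"

lemma branch_product_pair: "branch_product G [u, v] = weight G u v"
  by (simp add: branch_product_def)

lemma branch_product_Cons:
  assumes "length p \<ge> 2"
  shows "branch_product G (u # p)
    = weight G u (hd p) / (lam - weight G (hd p) (hd p)) * branch_product G p"
proof -
  let ?f = "\<lambda>k. weight G (p ! k) (p ! Suc k) / (lam - weight G (p ! k) (p ! k))"
  have p0: "p ! 0 = hd p" using assms by (cases p) auto
  have len: "length (u # p) - Suc 0 = Suc (length p - Suc 0)" using assms by simp
  have "branch_product G (u # p) = weight G u (hd p) * (\<Prod>k = 0..<length p - 1. ?f k)"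
    by (simp only: branch_product_def len One_nat_def prod.shift_bounds_Suc_ivl
        nth_Cons_0 nth_Cons_Suc p0)
  also have "(\<Prod>k = 0..<length p - 1. ?f k) = ?f 0 * (\<Prod>k = Suc 0..<length p - 1. ?f k)"
    using assms by (intro prod.atLeast_Suc_lessThan) simp
  finally show ?thesis using p0 by (simp add: branch_product_def)
qed

lemma successively_edges_subset:
  "successively (\<lambda>x y. (x, y) \<in> edges G) p \<Longrightarrow> length p \<ge> 2 \<Longrightarrow> set p \<subseteq> verts G"
proof (induction p rule: induct_list012)
  case (3 x y zs)
  then show ?case by (cases zs) (auto simp: edges_def)
qed auto

lemma finite_branches:
  assumes "finite (verts G)"
  shows "finite {p. branch G S u v p}"
proof (rule finite_subset)
  show "{p. branch G S u v p} \<subseteq> (#) u ` {p. set p \<subseteq> verts G \<and> distinct p}"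
  proof
    fix p assume "p \<in> {p. branch G S u v p}"
    then have b: "length p \<ge> 2" "hd p = u" "distinct (tl p)"
      "successively (\<lambda>x y. (x, y) \<in> edges G) p"
      by (auto simp: branch_def distinct_tl split: if_splits)
    moreover have "set (tl p) \<subseteq> verts G"
      using successively_edges_subset[OF b(4,1)] b(1) by (cases p) auto
    ultimately show "p \<in> (#) u ` {p. set p \<subseteq> verts G \<and> distinct p}"
      by (cases p) auto
  qed
  show "finite ((#) u ` {p. set p \<subseteq> verts G \<and> distinct p})"
    using finite_subset_distinct[OF assms] by simp
qed

lemma branch_pair: "branch G S u v [u, v] \<longleftrightarrow> (u, v) \<in> edges G"
  by (simp add: branch_def)

text \<open>If \<open>u \<noteq> v\<close> occurred again on \<open>p\<close>, the path from
  \<open>u\<close> through \<open>t\<close> back to \<open>u\<close> would be a cycle that is not a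
  loop and misses \<open>S\<close>. If \<open>u = v\<close>, the repeated vertex is allowed.\<close>

lemma branch_Cons:
  assumes S: "structural_set G S" and v: "v \<in> S" and t: "t \<notin> S" "t \<noteq> u" "(u, t) \<in> edges G"
    and p: "branch G S t v p"
  shows "branch G S u v (u # p)"
proof -
  have p': "length p \<ge> 2" "hd p = t" "last p = v" "distinct p"
    "successively (\<lambda>x y. (x, y) \<in> edges G) p" "set (butlast (tl p)) \<inter> S = {}"
    using p v t(1) by (auto simp: branch_def split: if_splits)
  obtain q where q: "p = t # q" "q \<noteq> []" using p'(1,2) by (cases p; cases "tl p") auto
  have interior: "set (butlast p) \<inter> S = {}" using p'(6) t(1) q by auto
  have "u \<notin> set p" if "u \<noteq> v"
  proof
    assume "u \<in> set p"
    then obtain xs ys where xs: "p = xs @ u # ys" by (meson split_list)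
    have "xs \<noteq> []" using xs q t(2) by auto
    have "ys \<noteq> []" using xs p'(3) that by auto
    then have sub: "set (xs @ [u]) \<subseteq> set (butlast p)"
      using xs by (auto simp: butlast_append)
    have hd_xs: "hd xs = t" using xs q \<open>xs \<noteq> []\<close> by (metis hd_append2 p'(2))
    have "cycle G (u # xs @ [u])"
      using p'(4,5) xs t(3) hd_xs \<open>xs \<noteq> []\<close>
      by (auto simp: cycle_def successively_Cons successively_append_iff)
    moreover have "length (u # xs @ [u]) \<noteq> 2" using \<open>xs \<noteq> []\<close> by simp
    ultimately have "set (u # xs @ [u]) \<inter> S \<noteq> {}"
      using S unfolding structural_set_def by blast
    then show False using sub interior by auto
  qed
  then show ?thesis using p' q t(3) interior by (auto simp: branch_def)
qed

lemma branch_cases: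
  assumes v: "v \<in> S" and p: "branch G S u v p"
  obtains "p = [u, v]" "(u, v) \<in> edges G"
  | t q where "t \<in> verts G - S - {u}" "(u, t) \<in> edges G" "branch G S t v q" "p = u # q"
proof -
  have p': "length p \<ge> 2" "hd p = u" "last p = v" "if u = v then distinct (tl p) else distinct p"
    "successively (\<lambda>x y. (x, y) \<in> edges G) p" "set (butlast (tl p)) \<inter> S = {}"
    using p by (auto simp: branch_def)
  obtain t r where r: "p = u # t # r" using p'(1,2) by (cases p; cases "tl p") auto
  have ut: "(u, t) \<in> edges G" using p'(5) r by simp
  show thesis
  proof (cases "r = []")
    case True
    then show thesis using that(1) r p'(3) ut by simp
  next
    case False
    then have tS: "t \<notin> S" using p'(6) r by auto
    have "t \<noteq> u" using p'(4) r tS v by (auto split: if_splits)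
    moreover have "branch G S t v (t # r)"
      using p' r False tS v
      by (auto simp: branch_def Suc_le_eq split: if_splits dest: in_set_butlastD)
    moreover have "t \<in> verts G" using ut by (simp add: edges_def)
    ultimately show thesis using that(2) tS ut r by auto
  qed
qed

lemma branches_eq:
  assumes "structural_set G S" "v \<in> S"
  shows "{p. branch G S u v p} = {p. p = [u, v] \<and> (u, v) \<in> edges G} \<union>
    (\<Union>t\<in>{t \<in> verts G - S - {u}. (u, t) \<in> edges G}. (#) u ` {p. branch G S t v p})"
  (is "?B = ?R")
proof (intro equalityI subsetI)
  fix p assume "p \<in> ?B"
  then have "branch G S u v p" by simp
  then show "p \<in> ?R"
    by (cases rule: branch_cases[OF assms(2), consumes 1]) auto
next
  fix p assume "p \<in> ?R"
  then consider "p = [u, v]" "(u, v) \<in> edges G"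
    | t q where "t \<in> verts G - S - {u}" "(u, t) \<in> edges G" "branch G S t v q" "p = u # q"
    by blast
  then show "p \<in> ?B"
  proof cases
    case 1
    then show ?thesis by (simp add: branch_pair)
  next
    case (2 t q)
    then show ?thesis using branch_Cons[OF assms, of t u q] by simp
  qed
qed

text \<open>Branches are sorted by their second vertex: either it is already the end
  \<open>v\<close>, or it lies outside \<open>S\<close> and the rest is a branch from there.\<close>

lemma branch_sum_rec:
  assumes fin: "finite (verts G)" and S: "structural_set G S" and u: "u \<in> verts G" and v: "v \<in> S"
  shows "branch_sum G S u v = weight G u v +
    (\<Sum>t\<in>verts G - S - {u}. weight G u t / (lam - weight G t t) * branch_sum G S t v)"
proof -
  let ?P = "{p. p = [u, v] \<and> (u, v) \<in> edges G}"
  let ?T = "{t \<in> verts G - S - {u}. (u, t) \<in> edges G}"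
  let ?Q = "\<lambda>t. (#) u ` {p. branch G S t v p}"
  have vG: "v \<in> verts G" using S v by (auto simp: structural_set_def)
  have finQ: "finite (?Q t)" for t using finite_branches[OF fin] by simp
  have finP: "finite ?P" by (rule finite_subset[of _ "{[u, v]}"]) auto
  have hd_branch: "hd p = t" "length p \<ge> 2" if "branch G S t v p" for p t
    using that by (auto simp: branch_def)
  have "[u, v] \<notin> ?Q t" for t using hd_branch(2)[of t "[v]"] by auto
  then have disj_PQ: "?P \<inter> (\<Union>t\<in>?T. ?Q t) = {}" by blast
  have disj_Q: "?Q s \<inter> ?Q t = {}" if "s \<noteq> t" for s t
  proof -
    have "\<not> (branch G S s v p \<and> branch G S t v p)" for p
      using hd_branch(1)[of s p] hd_branch(1)[of t p] that by blast
    then show ?thesis by blast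
  qed
  have "branch_sum G S u v = sum (branch_product G) ?P + sum (branch_product G) (\<Union>t\<in>?T. ?Q t)"
    unfolding branch_sum_def using finP finQ fin disj_PQ
    by (subst branches_eq[OF S v], intro sum.union_disjoint) simp_all
  also have "sum (branch_product G) ?P = weight G u v"
  proof (cases "(u, v) \<in> edges G")
    case True
    then have "?P = {[u, v]}" by auto
    then show ?thesis by (simp add: branch_product_pair)
  next
    case False
    then show ?thesis using u vG by (simp add: edges_def)
  qed
  also have "sum (branch_product G) (\<Union>t\<in>?T. ?Q t) = (\<Sum>t\<in>?T. sum (branch_product G) (?Q t))"
    using finQ fin disj_Q by (intro sum.UNION_disjoint) simp_all
  also have "\<dots> = (\<Sum>t\<in>?T. weight G u t / (lam - weight G t t) * branch_sum G S t v)"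
  proof (rule sum.cong)
    fix t
    have "sum (branch_product G) (?Q t) = (\<Sum>p\<in>{p. branch G S t v p}. branch_product G (u # p))"
      by (subst sum.reindex) (auto simp: inj_on_def)
    also have "\<dots> = (\<Sum>p\<in>{p. branch G S t v p}.
        weight G u t / (lam - weight G t t) * branch_product G p)"
      by (intro sum.cong) (simp_all add: branch_product_Cons hd_branch)
    finally show "sum (branch_product G) (?Q t)
        = weight G u t / (lam - weight G t t) * branch_sum G S t v"
      by (simp add: branch_sum_def sum_distrib_left)
  qed simp
  also have "\<dots> = (\<Sum>t\<in>verts G - S - {u}. weight G u t / (lam - weight G t t) * branch_sum G S t v)"
    using fin u by (intro sum.mono_neutral_left) (auto simp: edges_def)
  finally show ?thesis .
qed

lemma verts_reduction [simp]: "verts (reduction G S) = S"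
  by (simp add: reduction_def)

lemma weight_reduction: "weight (reduction G S) u v = (if u \<in> S \<and> v \<in> S then branch_sum G S u v else 0)"
  by (simp add: reduction_def branch_sum_def)


section \<open>Uniqueness of the reduced graph\<close>

text \<open>A vector on the vertices of \<open>H\<close> extends to one on \<open>G\<close> that satisfies the eigenvector equation
  off \<open>H\<close>, and \<open>H\<close> acts on the vector as \<open>G\<close> acts on the extension. Unlike the branch
  definition, this relation is visibly transitive.\<close>

definition compresses :: "'v wgraph \<Rightarrow> 'v wgraph \<Rightarrow> bool" where
  "compresses G H \<longleftrightarrow> verts H \<subseteq> verts G \<and>
     (\<forall>x. \<exists>y. (\<forall>u\<in>verts H. y u = x u) \<and>
        (\<forall>u\<in>verts G - verts H. (\<Sum>v\<in>verts G. weight G u v * y v) = lam * y u) \<and>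
        (\<forall>u\<in>verts H. (\<Sum>v\<in>verts H. weight H u v * x v) = (\<Sum>v\<in>verts G. weight G u v * y v)))"

lemma compresses_trans:
  assumes "compresses G H" "compresses H K"
  shows "compresses G K"
  unfolding compresses_def
proof (intro conjI allI)
  show "verts K \<subseteq> verts G" using assms by (auto simp: compresses_def)
  fix x
  obtain y where y: "\<forall>u\<in>verts K. y u = x u"
    "\<forall>u\<in>verts H - verts K. (\<Sum>v\<in>verts H. weight H u v * y v) = lam * y u"
    "\<forall>u\<in>verts K. (\<Sum>v\<in>verts K. weight K u v * x v) = (\<Sum>v\<in>verts H. weight H u v * y v)"
    using assms(2) unfolding compresses_def by blast
  obtain z where z: "\<forall>u\<in>verts H. z u = y u"
    "\<forall>u\<in>verts G - verts H. (\<Sum>v\<in>verts G. weight G u v * z v) = lam * z u"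
    "\<forall>u\<in>verts H. (\<Sum>v\<in>verts H. weight H u v * y v) = (\<Sum>v\<in>verts G. weight G u v * z v)"
    using assms(1) unfolding compresses_def by blast
  have KH: "verts K \<subseteq> verts H" using assms(2) by (simp add: compresses_def)
  show "\<exists>y. (\<forall>u\<in>verts K. y u = x u) \<and>
        (\<forall>u\<in>verts G - verts K. (\<Sum>v\<in>verts G. weight G u v * y v) = lam * y u) \<and>
        (\<forall>u\<in>verts K. (\<Sum>v\<in>verts K. weight K u v * x v) = (\<Sum>v\<in>verts G. weight G u v * y v))"
  proof (intro exI[of _ z] conjI ballI)
    fix u assume "u \<in> verts K"
    then show "z u = x u" using y(1) z(1) KH by auto
  next
    fix u assume u: "u \<in> verts G - verts K"
    show "(\<Sum>v\<in>verts G. weight G u v * z v) = lam * z u"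
      using y(2) z u by (cases "u \<in> verts H") auto
  next
    fix u assume "u \<in> verts K"
    then show "(\<Sum>v\<in>verts K. weight K u v * x v) = (\<Sum>v\<in>verts G. weight G u v * z v)"
      using y(3) z(3) KH by auto
  qed
qed

lemma compresses_reduction:
  assumes fin: "finite (verts G)" and S: "structural_set G S"
  shows "compresses G (reduction G S)"
  unfolding compresses_def verts_reduction
proof (intro conjI allI)
  show SG: "S \<subseteq> verts G" using S by (simp add: structural_set_def)
  fix x :: "'a \<Rightarrow> ratfun"
  let ?T = "verts G - S"
  define b where "b u = (\<Sum>v\<in>S. branch_sum G S u v * x v)" for u
  \<comment> \<open>Off \<open>S\<close> the eigenvector equation says that
    \<open>(lam - weight G u u) * y u\<close> is the sum over all other vertices. The branch
    recursion shows that \<open>b u\<close> is this sum.\<close>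
  define y where "y u = (if u \<in> S then x u else b u / (lam - weight G u u))" for u
  have nz: "lam - weight G u u \<noteq> 0" if "u \<in> ?T" for u
    using S that unfolding structural_set_def by (metis eq_iff_diff_eq_0)
  have b_rec: "b u = (\<Sum>v\<in>S. weight G u v * y v) + (\<Sum>t\<in>?T - {u}. weight G u t * y t)"
    if u: "u \<in> verts G" for u
  proof -
    have "b u = (\<Sum>v\<in>S. weight G u v * x v) +
        (\<Sum>v\<in>S. \<Sum>t\<in>?T - {u}. weight G u t / (lam - weight G t t) * (branch_sum G S t v * x v))"
      unfolding b_def sum.distrib[symmetric]
      by (intro sum.cong)
        (simp_all add: branch_sum_rec[OF fin S u] distrib_right sum_distrib_right mult.assoc)
    also have "(\<Sum>v\<in>S. \<Sum>t\<in>?T - {u}. weight G u t / (lam - weight G t t) * (branch_sum G S t v * x v))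
        = (\<Sum>t\<in>?T - {u}. weight G u t / (lam - weight G t t) * b t)"
      by (subst sum.swap) (simp add: b_def sum_distrib_left)
    also have "\<dots> = (\<Sum>t\<in>?T - {u}. weight G u t * y t)"
      by (intro sum.cong) (auto simp: y_def)
    also have "(\<Sum>v\<in>S. weight G u v * x v) = (\<Sum>v\<in>S. weight G u v * y v)"
      by (intro sum.cong) (auto simp: y_def)
    finally show ?thesis .
  qed
  have split: "(\<Sum>v\<in>verts G. weight G u v * y v)
      = (\<Sum>v\<in>S. weight G u v * y v) + (\<Sum>t\<in>?T. weight G u t * y t)" for u
    using sum.subset_diff[OF SG fin, of "\<lambda>v. weight G u v * y v"] by (simp add: add.commute)
  show "\<exists>y. (\<forall>u\<in>S. y u = x u) \<and>
      (\<forall>u\<in>verts G - S. (\<Sum>v\<in>verts G. weight G u v * y v) = lam * y u) \<and>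
      (\<forall>u\<in>S. (\<Sum>v\<in>S. weight (reduction G S) u v * x v) = (\<Sum>v\<in>verts G. weight G u v * y v))"
  proof (intro exI[of _ y] conjI ballI)
    fix u assume u: "u \<in> ?T"
    then have "(\<Sum>v\<in>verts G. weight G u v * y v) = weight G u u * y u + b u"
      unfolding split using b_rec[of u] fin by (simp add: sum.remove[of ?T u])
    also have "b u = (lam - weight G u u) * y u" using nz[OF u] u by (simp add: y_def)
    finally show "(\<Sum>v\<in>verts G. weight G u v * y v) = lam * y u" by (simp add: algebra_simps)
  next
    fix u assume u: "u \<in> S"
    then have "?T - {u} = ?T" by auto
    then have "b u = (\<Sum>v\<in>verts G. weight G u v * y v)"
      using b_rec[of u] u SG unfolding split by auto
    then show "(\<Sum>v\<in>S. weight (reduction G S) u v * x v) = (\<Sum>v\<in>verts G. weight G u v * y v)"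
      using u by (simp add: weight_reduction b_def)
  qed (simp add: y_def)
qed

text \<open>Both matrices are applied to the unit vector at \<open>v\<close>. The two extensions to
  \<open>G\<close> differ by a vector supported off \<open>verts H\<close> that satisfies the
  eigenvector equation there; since the weights are proper, \<open>proper_eigenvector_zero\<close>
  makes it vanish, so the columns at \<open>v\<close> agree.\<close>

lemma compresses_unique:
  assumes G: "G \<in> graphs_pi" and H: "compresses G H" "compresses G K" "verts H = verts K"
    and u: "u \<in> verts H" and v: "v \<in> verts H"
  shows "weight H u v = weight K u v"
proof -
  have fin: "finite (verts G)" using G by (simp add: graphs_pi_def graphs_def)
  have sub: "verts H \<subseteq> verts G" using H by (simp add: compresses_def)
  define x :: "_ \<Rightarrow> ratfun" where "x w = (if w = v then 1 else 0)" for w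
  obtain y where y: "\<forall>u\<in>verts H. y u = x u"
    "\<forall>u\<in>verts G - verts H. (\<Sum>v\<in>verts G. weight G u v * y v) = lam * y u"
    "\<forall>u\<in>verts H. (\<Sum>v\<in>verts H. weight H u v * x v) = (\<Sum>v\<in>verts G. weight G u v * y v)"
    using H(1) unfolding compresses_def by blast
  obtain z where z: "\<forall>u\<in>verts H. z u = x u"
    "\<forall>u\<in>verts G - verts H. (\<Sum>v\<in>verts G. weight G u v * z v) = lam * z u"
    "\<forall>u\<in>verts H. (\<Sum>v\<in>verts H. weight K u v * x v) = (\<Sum>v\<in>verts G. weight G u v * z v)"
    using H(2) unfolding compresses_def H(3) by blast
  have diff: "(\<Sum>v\<in>verts G - verts H. weight G u v * (y v - z v))
      = (\<Sum>v\<in>verts G. weight G u v * y v) - (\<Sum>v\<in>verts G. weight G u v * z v)" for u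
  proof -
    have "(\<Sum>v\<in>verts G - verts H. weight G u v * (y v - z v))
        = (\<Sum>v\<in>verts G. weight G u v * (y v - z v))"
      using fin y(1) z(1) by (intro sum.mono_neutral_left) auto
    then show ?thesis by (simp add: right_diff_distrib sum_subtractf)
  qed
  have "y w - z w = 0" if "w \<in> verts G - verts H" for w
  proof (rule proper_eigenvector_zero[of "verts G - verts H" "weight G" "\<lambda>w. y w - z w"])
    show "proper (weight G s t)" if "s \<in> verts G - verts H" "t \<in> verts G - verts H" for s t
      using G that by (simp add: graphs_pi_def proper_def)
    show "(\<Sum>t\<in>verts G - verts H. weight G s t * (y t - z t)) = lam * (y s - z s)"
      if "s \<in> verts G - verts H" for s
      unfolding diff using y(2) z(2) that by (simp add: right_diff_distrib)
  qed (use fin that in auto)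
  then have "(\<Sum>w\<in>verts G. weight G u w * y w) = (\<Sum>w\<in>verts G. weight G u w * z w)"
    using diff[of u] by simp
  then have "(\<Sum>w\<in>verts H. weight H u w * x w) = (\<Sum>w\<in>verts H. weight K u w * x w)"
    using y(3) z(3) u by simp
  moreover have "(\<Sum>w\<in>verts H. f w * x w) = f v" for f
    using v finite_subset[OF sub fin] by (simp add: x_def sum.delta if_distrib cong: if_cong)
  ultimately show ?thesis by simp
qed

text \<open>The last conjunct is recorded so that agreement of weights on the final vertex set gives
  equality of graphs as records.\<close>

lemma reduction_seq_compresses:
  assumes "finite (verts G)" "reduction_seq G Ss" "Ss \<noteq> []"
  shows "compresses G (foldl reduction G Ss) \<and> verts (foldl reduction G Ss) = last Ss \<and>
    (\<forall>u v. weight (foldl reduction G Ss) u v \<noteq> 0 \<longrightarrow> u \<in> last Ss \<and> v \<in> last Ss)"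
  using assms
proof (induction Ss arbitrary: G)
  case (Cons S Ss)
  have S: "structural_set G S" and Ss: "reduction_seq (reduction G S) Ss" using Cons.prems by auto
  have fin: "finite (verts (reduction G S))"
    using S Cons.prems(1) by (auto simp: structural_set_def intro: finite_subset)
  have c: "compresses G (reduction G S)" by (rule compresses_reduction[OF Cons.prems(1) S])
  show ?case
  proof (cases "Ss = []")
    case True
    then show ?thesis using c by (auto simp: weight_reduction)
  next
    case False
    then show ?thesis using Cons.IH[OF fin Ss False] compresses_trans[OF c] by simp
  qed
qed simp

text \<open>Any two sequences ending in \<open>V\<close> give compressions of \<open>G\<close> to
  the same vertex set, so the definite description has a single candidate.\<close>

lemma reduce_to_eq:
  assumes G: "G \<in> graphs_pi" and Ss: "reduction_seq G Ss" "Ss \<noteq> []" "last Ss = V"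
  shows "reduce_to G V = foldl reduction G Ss"
  unfolding reduce_to_def
proof (rule the_equality)
  show "\<exists>Ts. Ts \<noteq> [] \<and> reduction_seq G Ts \<and> last Ts = V \<and> foldl reduction G Ss = foldl reduction G Ts"
    using Ss by blast
next
  have fin: "finite (verts G)" using G by (simp add: graphs_pi_def graphs_def)
  fix H assume "\<exists>Ts. Ts \<noteq> [] \<and> reduction_seq G Ts \<and> last Ts = V \<and> H = foldl reduction G Ts"
  then obtain Ts where Ts: "reduction_seq G Ts" "Ts \<noteq> []" "last Ts = V" "H = foldl reduction G Ts"
    by blast
  let ?K = "foldl reduction G Ss"
  note h = reduction_seq_compresses[OF fin Ts(1,2), folded Ts(4), unfolded Ts(3)]
  note k = reduction_seq_compresses[OF fin Ss(1,2), unfolded Ss(3)]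
  have "weight H u v = weight ?K u v" for u v
  proof (cases "u \<in> V \<and> v \<in> V")
    case True
    then show ?thesis using compresses_unique[OF G, of H ?K u v] h k by simp
  next
    case False
    then show ?thesis using h k by metis
  qed
  then show "H = ?K" using h k by (intro wgraph.equality) auto
qed


section \<open>Removing one vertex at a time\<close>

lemma structural_set_verts: "verts G \<noteq> {} \<Longrightarrow> structural_set G (verts G)"
proof -
  assume "verts G \<noteq> {}"
  moreover have "set p \<inter> verts G \<noteq> {}" if "cycle G p" for p
  proof -
    have "length p \<ge> 2" "set p \<subseteq> verts G"
      using that successively_edges_subset[of G p] by (auto simp: cycle_def)
    then show ?thesis by (cases p) auto
  qed
  ultimately show ?thesis by (simp add: structural_set_def)
qed

text \<open>The tail of a cycle that is not a loop contains two distinct vertices, and at most one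
  of them is \<open>t\<close>.\<close>

lemma structural_set_remove_vertex:
  assumes "t \<in> verts G" "verts G - {t} \<noteq> {}" "weight G t t \<noteq> lam"
  shows "structural_set G (verts G - {t})"
proof -
  have "set p \<inter> (verts G - {t}) \<noteq> {}" if cyc: "cycle G p" and len: "length p \<noteq> 2" for p
  proof -
    have p: "length p \<ge> 2" "set p \<subseteq> verts G" "distinct (tl p)"
      using cyc successively_edges_subset[of G p] by (auto simp: cycle_def)
    then obtain a b c r where r: "p = a # b # c # r"
      using len by (cases p; cases "tl p"; cases "tl (tl p)") auto
    then have "b \<noteq> c" using p(3) by auto
    then show ?thesis using r p(2) by auto
  qed
  with assms show ?thesis by (auto simp: structural_set_def)
qed

text \<open>Sequences ending in \<open>V\<close> are nonempty, so even \<open>V = verts G\<close>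
  takes one reduction. With no vertex left for the interior, the only branches are single
  edges.\<close>

lemma reduction_verts:
  assumes "G \<in> graphs"
  shows "reduction G (verts G) = G"
proof -
  have fin: "finite (verts G)" and ne: "verts G \<noteq> {}"
    and pin: "\<And>u v. weight G u v \<noteq> 0 \<Longrightarrow> u \<in> verts G \<and> v \<in> verts G"
    using assms by (auto simp: graphs_def)
  have "weight (reduction G (verts G)) u v = weight G u v" for u v
    using branch_sum_rec[OF fin structural_set_verts[OF ne], of u v] pin[of u v]
    by (auto simp: weight_reduction)
  then show ?thesis by (intro wgraph.equality) auto
qed

text \<open>The recursion is unfolded twice: from \<open>u\<close> the only possible interior vertex
  is \<open>t\<close>, and from \<open>t\<close> none remains.\<close>

lemma weight_reduction_remove_vertex:
  assumes fin: "finite (verts G)" and t: "t \<in> verts G"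
    and S: "structural_set G (verts G - {t})" and "u \<in> verts G - {t}" "v \<in> verts G - {t}"
  shows "weight (reduction G (verts G - {t})) u v
    = weight G u v + weight G u t * weight G t v / (lam - weight G t t)"
proof -
  have T: "verts G - (verts G - {t}) = {t}" using t by auto
  have "{t} - {u} = {t}" using assms(4) by auto
  then show ?thesis
    using branch_sum_rec[OF fin S, of u v] branch_sum_rec[OF fin S t, of v] assms(4,5)
    by (simp add: T weight_reduction)
qed

lemma reduction_remove_vertex_graphs_pi:
  assumes G: "G \<in> graphs_pi" and t: "t \<in> verts G" and S: "structural_set G (verts G - {t})"
  shows "reduction G (verts G - {t}) \<in> graphs_pi"
proof -
  have fin: "finite (verts G)" using G by (simp add: graphs_pi_def graphs_def)
  have entry_proper: "proper (weight G u v)" if "u \<in> verts G" "v \<in> verts G" for u v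
    using G that by (simp add: graphs_pi_def proper_def)
  have "proper (weight (reduction G (verts G - {t})) u v)"
    if "u \<in> verts G - {t}" "v \<in> verts G - {t}" for u v
    unfolding weight_reduction_remove_vertex[OF fin t S that] divide_inverse
    using that t by (intro proper_add proper_mult proper_inverse_lam_diff entry_proper) auto
  moreover have "reduction G (verts G - {t}) \<in> graphs"
    using fin S by (simp add: graphs_def structural_set_def weight_reduction)
  ultimately show ?thesis
    unfolding graphs_pi_def proper_def by simp
qed

text \<open>Induction on the number of vertices still to be removed. Weights stay proper, so no loop
  weight equals \<open>lam\<close> and any vertex outside \<open>V\<close> can go next; the
  inclusions for single vertices are chained.\<close>

lemma exists_reduction_seq:
  assumes "G \<in> graphs_pi" "V \<subseteq> verts G" "card V \<ge> 2"
  shows "\<exists>Ss. Ss \<noteq> [] \<and> reduction_seq G Ss \<and> last Ss = V \<and>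
    brauer_region (foldl reduction G Ss) \<subseteq> brauer_region G"
  using assms
proof (induction "card (verts G - V)" arbitrary: G)
  case 0
  have G: "G \<in> graphs" and fin: "finite (verts G)" and ne: "verts G \<noteq> {}"
    using 0 by (auto simp: graphs_pi_def graphs_def)
  have "V = verts G" using 0 fin by auto
  then show ?case
    using reduction_verts[OF G] structural_set_verts[OF ne] by (intro exI[of _ "[V]"]) simp
next
  case (Suc n)
  have fin: "finite (verts G)" using Suc by (auto simp: graphs_pi_def graphs_def)
  have "verts G - V \<noteq> {}" using Suc.hyps(2) by (metis card.empty nat.distinct(1))
  then obtain t where t: "t \<in> verts G" "t \<notin> V" by blast
  define S where "S = verts G - {t}"
  have VS: "V \<subseteq> S" using Suc.prems t by (auto simp: S_def)
  have card: "card S \<ge> 2" using card_mono[OF _ VS] fin Suc.prems(3) by (simp add: S_def)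
  have "proper (weight G t t)" using Suc.prems(1) t by (simp add: graphs_pi_def proper_def)
  then have "weight G t t \<noteq> lam" using not_proper_lam by auto
  moreover have "S \<noteq> {}" using card by auto
  ultimately have S: "structural_set G S"
    using structural_set_remove_vertex[OF t(1)] unfolding S_def by blast
  let ?R = "reduction G S"
  have "S - V = (verts G - V) - {t}" by (auto simp: S_def)
  then have "n = card (verts ?R - V)" using Suc.hyps(2) t fin by simp
  moreover have "?R \<in> graphs_pi"
    using reduction_remove_vertex_graphs_pi[OF Suc.prems(1) t(1)] S by (simp add: S_def)
  ultimately obtain Ss where Ss: "Ss \<noteq> []" "reduction_seq ?R Ss" "last Ss = V"
      "brauer_region (foldl reduction ?R Ss) \<subseteq> brauer_region ?R"
    using Suc.hyps(1)[of ?R] VS Suc.prems(3) by auto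
  have "brauer_region ?R \<subseteq> brauer_region G"
    using card weight_reduction_remove_vertex[OF fin t(1)] S
    by (intro eliminate_vertex_brauer_region[OF fin t(1)]) (simp_all add: S_def)
  then show ?case using Ss S by (intro exI[of _ "S # Ss"]) auto
qed

theorem theorem5p3:
  fixes G :: "'v wgraph" and V :: "'v set"
  assumes "G \<in> graphs_pi"
    and "V \<subseteq> verts G"
    and "card V \<ge> 2"
  shows "brauer_region (reduce_to G V) \<subseteq> brauer_region G"
proof -
  obtain Ss where "Ss \<noteq> []" "reduction_seq G Ss" "last Ss = V"
    "brauer_region (foldl reduction G Ss) \<subseteq> brauer_region G"
    using exists_reduction_seq[OF assms] by blast
  then show ?thesis using reduce_to_eq[OF assms(1)] by simp
qed

end
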